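(* Let $\Lambda$ be a consistent normal modal logic with canonical frame $\mathcal F_\Lambda$. Suppose that $\Lambda$ is valid in every finite conversely well-founded semisubframe of $\mathcal F_\Lambda$ and that $\Lambda\supseteq \mathrm{GL}_{\Diamond^2\sigma_n}$ for some $n\geq 1$. Then $\Lambda$ has the finite model property.
   Context: Modal formulas are built from countably many propositional variables and $\bot$ using $\to$ and a unary modality $\Diamond$; other connectives are abbreviations, $\Diamond^0\varphi:=\varphi$, $\Diamond^{k+1}\varphi:=\Diamond\Diamond^k\varphi$. A (normal modal) logic is a set of formulas containing all classical tautologies, $\Diamond\bot\to\bot$ and $\Diamond(p\vee q)\to\Diamond p\vee\Diamond q$, and closed under modus ponens, substitution, and the rule $\varphi\to\psi\,/\,\Diamond\varphi\to\Diamond\psi$. $\mathrm K$ is the smallest logic; a logic is consistent if it is not the set of all formulas; $\Lambda+\varphi$ is the smallest logic containing $\Lambda$ and $\varphi$. For a variable $p$: $\sigma_1:=p$ and $\sigma_n:=p\wedge\Diamond\sigma_{n-1}$ for $n>1$. $\mathrm{GL}_{\Diamond^2\sigma_n}:=\mathrm K+\bigl(\Diamond p\to\Diamond(p\wedge\neg\Diamond\sigma_n)\bigr)$. A Kripke frame is $\mathcal F=(W,R)$ with $W\neq\emptyset$ and $R\subseteq W\times W$; validity is the usual Kripke validity, with $\Diamond\varphi$ true at $w$ iff $\varphi$ is true at some $v$ with $w\mathrel R v$. A logic is valid in a frame if all its formulas are. $R^*$ is the reflexive transitive closure of $R$. A frame $(W,R)$ is conversely well-founded if there is no infinite sequence $w_0,w_1,\dots$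 with $w_k\mathrel R w_{k+1}$ for all $k$. $(W,R)$ is a semisubframe of $(W_0,R_0)$ if $\emptyset\neq W\subseteq W_0$, $R\subseteq R_0$, and for all $w,v\in W$: if $w\mathrel{R^*}v$ and $w\mathrel{R_0}v$, then $w\mathrel R v$. The canonical frame $\mathcal F_\Lambda=(W_\Lambda,R_\Lambda)$ of a consistent logic $\Lambda$: $W_\Lambda$ is the set of maximal $\Lambda$-consistent sets of formulas, and $w\mathrel{R_\Lambda}v$ iff $\varphi\in v$ whenever $\Box\varphi\in w$, where $\Box\varphi:=\neg\Diamond\neg\varphi$. A logic has the finite model property if it is the set of all formulas valid in some class of finite frames. *)

theory Defs
  imports Main
begin

section \<open>Modal formulas\<close>

datatype fm = Var nat | Bot | Imp fm fm | Dia fm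

abbreviation Neg :: "fm \<Rightarrow> fm" where "Neg \<phi> \<equiv> Imp \<phi> Bot"
abbreviation Top :: fm where "Top \<equiv> Neg Bot"
abbreviation Or :: "fm \<Rightarrow> fm \<Rightarrow> fm" where "Or \<phi> \<psi> \<equiv> Imp (Neg \<phi>) \<psi>"
abbreviation And :: "fm \<Rightarrow> fm \<Rightarrow> fm" where "And \<phi> \<psi> \<equiv> Neg (Imp \<phi> (Neg \<psi>))"
abbreviation Box :: "fm \<Rightarrow> fm" where "Box \<phi> \<equiv> Neg (Dia (Neg \<phi>))"

definition Conj :: "fm list \<Rightarrow> fm" where
  "Conj \<phi>s = foldr And \<phi>s Top"

primrec subst :: "(nat \<Rightarrow> fm) \<Rightarrow> fm \<Rightarrow> fm" where
  "subst s (Var n) = s n"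
| "subst s Bot = Bot"
| "subst s (Imp \<phi> \<psi>) = Imp (subst s \<phi>) (subst s \<psi>)"
| "subst s (Dia \<phi>) = Dia (subst s \<phi>)"

section \<open>Normal modal logics\<close>

text \<open>Classical evaluation, in which the variables and the formulas \<open>Dia \<phi>\<close> are
  the propositional atoms; thus the substitution instances of tautologies are tautologies.\<close>

primrec prop_eval :: "(fm \<Rightarrow> bool) \<Rightarrow> fm \<Rightarrow> bool" where
  "prop_eval v (Var n) = v (Var n)"
| "prop_eval v Bot = False"
| "prop_eval v (Imp \<phi> \<psi>) = (prop_eval v \<phi> \<longrightarrow> prop_eval v \<psi>)"
| "prop_eval v (Dia \<phi>) = v (Dia \<phi>)"

definition tautology :: "fm \<Rightarrow> bool" where
  "tautology \<phi> \<longleftrightarrow> (\<forall>v. prop_eval v \<phi>)"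

definition normal_logic :: "fm set \<Rightarrow> bool" where
  "normal_logic \<Lambda> \<longleftrightarrow>
     (\<forall>\<phi>. tautology \<phi> \<longrightarrow> \<phi> \<in> \<Lambda>) \<and>
     Imp (Dia Bot) Bot \<in> \<Lambda> \<and>
     Imp (Dia (Or (Var 0) (Var 1))) (Or (Dia (Var 0)) (Dia (Var 1))) \<in> \<Lambda> \<and>
     (\<forall>\<phi> \<psi>. \<phi> \<in> \<Lambda> \<and> Imp \<phi> \<psi> \<in> \<Lambda> \<longrightarrow> \<psi> \<in> \<Lambda>) \<and>
     (\<forall>\<phi> s. \<phi> \<in> \<Lambda> \<longrightarrow> subst s \<phi> \<in> \<Lambda>) \<and>
     (\<forall>\<phi> \<psi>. Imp \<phi> \<psi> \<in> \<Lambda> \<longrightarrow> Imp (Dia \<phi>) (Dia \<psi>) \<in> \<Lambda>)"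

lemma normal_logic_Inter:
  "(\<And>\<Lambda>. \<Lambda> \<in> A \<Longrightarrow> normal_logic \<Lambda>) \<Longrightarrow> normal_logic (\<Inter>A)"
  unfolding normal_logic_def by blast

definition consistent_logic :: "fm set \<Rightarrow> bool" where
  "consistent_logic \<Lambda> \<longleftrightarrow> \<Lambda> \<noteq> UNIV"

definition K_logic :: "fm set" where
  "K_logic = \<Inter>{\<Lambda>. normal_logic \<Lambda>}"

definition logic_plus :: "fm set \<Rightarrow> fm \<Rightarrow> fm set" where
  "logic_plus \<Lambda> \<phi> = \<Inter>{\<Lambda>'. normal_logic \<Lambda>' \<and> \<Lambda> \<subseteq> \<Lambda>' \<and> \<phi> \<in> \<Lambda>'}"

text \<open>Indexed from 1; \<open>sigma p 0\<close> is unspecified.\<close>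

fun sigma :: "nat \<Rightarrow> nat \<Rightarrow> fm" where
  "sigma p (Suc 0) = Var p"
| "sigma p (Suc (Suc n)) = And (Var p) (Dia (sigma p (Suc n)))"

definition GL_sigma :: "nat \<Rightarrow> fm set" where
  "GL_sigma n = logic_plus K_logic
     (Imp (Dia (Var 0)) (Dia (And (Var 0) (Neg (Dia (sigma 0 n))))))"

section \<open>Kripke semantics\<close>

type_synonym 'w frame = "'w set \<times> 'w rel"

definition is_frame :: "'w frame \<Rightarrow> bool" where
  "is_frame F \<longleftrightarrow> fst F \<noteq> {} \<and> snd F \<subseteq> fst F \<times> fst F"

primrec sat :: "'w frame \<Rightarrow> (nat \<Rightarrow> 'w set) \<Rightarrow> 'w \<Rightarrow> fm \<Rightarrow> bool" where
  "sat F V w (Var n) \<longleftrightarrow> w \<in> V n"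
| "sat F V w Bot \<longleftrightarrow> False"
| "sat F V w (Imp \<phi> \<psi>) \<longleftrightarrow> (sat F V w \<phi> \<longrightarrow> sat F V w \<psi>)"
| "sat F V w (Dia \<phi>) \<longleftrightarrow> (\<exists>v\<in>fst F. (w, v) \<in> snd F \<and> sat F V v \<phi>)"

definition valid_in :: "'w frame \<Rightarrow> fm \<Rightarrow> bool" where
  "valid_in F \<phi> \<longleftrightarrow> (\<forall>V. (\<forall>n. V n \<subseteq> fst F) \<longrightarrow> (\<forall>w\<in>fst F. sat F V w \<phi>))"

definition logic_valid_in :: "'w frame \<Rightarrow> fm set \<Rightarrow> bool" where
  "logic_valid_in F \<Lambda> \<longleftrightarrow> (\<forall>\<phi>\<in>\<Lambda>. valid_in F \<phi>)"

definition finite_frame :: "'w frame \<Rightarrow> bool" where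
  "finite_frame F \<longleftrightarrow> finite (fst F)"

definition conversely_wf :: "'w frame \<Rightarrow> bool" where
  "conversely_wf F \<longleftrightarrow> \<not> (\<exists>w :: nat \<Rightarrow> 'w. \<forall>k. (w k, w (Suc k)) \<in> snd F)"

definition semisubframe :: "'w frame \<Rightarrow> 'w frame \<Rightarrow> bool" where
  "semisubframe F F0 \<longleftrightarrow> is_frame F \<and> fst F \<subseteq> fst F0 \<and> snd F \<subseteq> snd F0 \<and>
     (\<forall>w\<in>fst F. \<forall>v\<in>fst F. (w, v) \<in> (snd F)\<^sup>* \<and> (w, v) \<in> snd F0 \<longrightarrow> (w, v) \<in> snd F)"

text \<open>Every finite frame is isomorphic to one whose worlds are natural numbers, and
  isomorphic frames validate the same formulas, so a class of finite frames is
  represented by a set of finite frames over \<open>nat\<close>.\<close>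

definition finite_model_property :: "fm set \<Rightarrow> bool" where
  "finite_model_property \<Lambda> \<longleftrightarrow>
     (\<exists>\<C> :: nat frame set. (\<forall>F\<in>\<C>. is_frame F \<and> finite_frame F) \<and>
        \<Lambda> = {\<phi>. \<forall>F\<in>\<C>. valid_in F \<phi>})"

section \<open>Canonical frames\<close>

definition consistent_set :: "fm set \<Rightarrow> fm set \<Rightarrow> bool" where
  "consistent_set \<Lambda> \<Gamma> \<longleftrightarrow> \<not> (\<exists>\<phi>s. set \<phi>s \<subseteq> \<Gamma> \<and> Neg (Conj \<phi>s) \<in> \<Lambda>)"

definition maximal_consistent :: "fm set \<Rightarrow> fm set \<Rightarrow> bool" where
  "maximal_consistent \<Lambda> \<Gamma> \<longleftrightarrow> consistent_set \<Lambda> \<Gamma> \<and>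
     (\<forall>\<Delta>. \<Gamma> \<subset> \<Delta> \<longrightarrow> \<not> consistent_set \<Lambda> \<Delta>)"

definition canonical_frame :: "fm set \<Rightarrow> fm set frame" where
  "canonical_frame \<Lambda> =
     ({w. maximal_consistent \<Lambda> w},
      {(w, v). maximal_consistent \<Lambda> w \<and> maximal_consistent \<Lambda> v \<and>
               (\<forall>\<phi>. Box \<phi> \<in> w \<longrightarrow> \<phi> \<in> v)})"

end

theory Submission
  imports Defs
begin

text \<open>
  Given \<open>\<phi> \<notin> \<Lambda>\<close>, let \<open>S\<close> consist of the formulas \<open>\<chi> \<and> \<not>\<diamond>\<sigma>\<^sub>n(\<chi>)\<close> with \<open>\<chi>\<close> a subformula of \<open>\<phi>\<close>;
  every \<open>\<diamond>\<chi>\<close> true at a canonical world has a witness satisfying the corresponding member of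
  \<open>S\<close>, and such worlds are irreflexive. Call a world selectable if it lies in a finite set \<open>W\<close> of
  worlds carrying an acyclic subrelation \<open>E\<close> of the canonical relation \<open>R\<close> that witnesses every
  \<open>\<diamond>\<psi>\<close> with \<open>\<psi> \<in> S\<close>. On the irreflexive part of \<open>W\<close>, the relation \<open>E\<^sup>* \<inter> R\<close> is then a finite
  conversely well-founded semisubframe satisfying the truth lemma for subformulas of \<open>\<phi>\<close>.

  It remains to see that every world is selectable. The set \<open>D\<close> of the other worlds is the
  greatest set each of whose members \<open>d\<close> has some \<open>\<psi> \<in> S\<close> with \<open>\<emptyset> \<noteq> R(d) \<inter> \<psi> \<subseteq> D\<close>; hence it is
  topologically closed. For \<open>d \<in> D\<close> let \<open>T(d)\<close> be the set of these \<open>\<psi>\<close>, and \<open>B(d)\<close> the set of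
  \<open>\<psi> \<in> S\<close> that \<open>d\<close> sees outside \<open>D\<close> but arbitrarily close to \<open>D\<close>, so that \<open>d\<close> also sees \<open>\<psi>\<close>
  inside \<open>D\<close>. Take \<open>a \<in> D\<close> with \<open>|B(a)|\<close> minimal. Some formula \<open>p\<close> holds at all members of \<open>D\<close>
  satisfying an element of \<open>S - B(a)\<close>, while \<open>R(a) \<inter> p \<subseteq> D\<close>. The axiom, applied to \<open>p\<close> at \<open>a\<close>,
  yields a world of \<open>D \<inter> p\<close> from which no \<open>R\<close>-path of length \<open>n\<close> stays in \<open>p\<close>. But every
  \<open>x \<in> D\<close> has a successor in \<open>D \<inter> p\<close>: otherwise \<open>T(x) \<union> B(x) \<subseteq> B(a)\<close>, and \<open>B(x)\<close> would be
  smaller than \<open>B(a)\<close>, since \<open>T(x)\<close> is nonempty and disjoint from \<open>B(x)\<close>.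
\<close>

section \<open>Canonical models\<close>

lemma prop_eval_Conj: "prop_eval v (Conj \<phi>s) \<longleftrightarrow> (\<forall>\<phi>\<in>set \<phi>s. prop_eval v \<phi>)"
  by (induction \<phi>s) (auto simp: Conj_def)

locale normal_modal_logic =
  fixes \<Lambda> :: "fm set"
  assumes normal: "normal_logic \<Lambda>"
begin

abbreviation mcs :: "fm set \<Rightarrow> bool" where
  "mcs \<equiv> maximal_consistent \<Lambda>"

definition acc :: "fm set \<Rightarrow> fm set \<Rightarrow> bool" where
  "acc w v \<longleftrightarrow> (w, v) \<in> snd (canonical_frame \<Lambda>)"

lemma acc_iff: "acc w v \<longleftrightarrow> mcs w \<and> mcs v \<and> (\<forall>\<phi>. Box \<phi> \<in> w \<longrightarrow> \<phi> \<in> v)"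
  by (simp add: acc_def canonical_frame_def)

lemma acc_mcs: assumes "acc w v" shows "mcs w" "mcs v"
  using assms unfolding acc_iff by blast+

lemma acc_Box: "acc w v \<Longrightarrow> Box \<phi> \<in> w \<Longrightarrow> \<phi> \<in> v"
  unfolding acc_iff by blast

lemma taut: "(\<And>v. prop_eval v \<phi>) \<Longrightarrow> \<phi> \<in> \<Lambda>"
  using normal by (simp add: normal_logic_def tautology_def)

lemma mp: "Imp \<phi> \<psi> \<in> \<Lambda> \<Longrightarrow> \<phi> \<in> \<Lambda> \<Longrightarrow> \<psi> \<in> \<Lambda>"
  using normal unfolding normal_logic_def by blast

lemma taut_consequence:
  assumes "\<phi> \<in> \<Lambda>" "\<And>v. prop_eval v \<phi> \<Longrightarrow> prop_eval v \<psi>"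
  shows "\<psi> \<in> \<Lambda>"
  using mp[OF taut[of "Imp \<phi> \<psi>"]] assms by simp

lemma subst_closed: "\<phi> \<in> \<Lambda> \<Longrightarrow> subst s \<phi> \<in> \<Lambda>"
  using normal unfolding normal_logic_def by blast

lemma Dia_Imp: "Imp \<phi> \<psi> \<in> \<Lambda> \<Longrightarrow> Imp (Dia \<phi>) (Dia \<psi>) \<in> \<Lambda>"
  using normal unfolding normal_logic_def by blast

lemma Dia_Bot: "Imp (Dia Bot) Bot \<in> \<Lambda>"
  using normal unfolding normal_logic_def by blast

lemma Dia_Or: "Imp (Dia (Or \<phi> \<psi>)) (Or (Dia \<phi>) (Dia \<psi>)) \<in> \<Lambda>"
proof -
  have "Imp (Dia (Or (Var 0) (Var 1))) (Or (Dia (Var 0)) (Dia (Var 1))) \<in> \<Lambda>"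
    using normal unfolding normal_logic_def by blast
  from subst_closed[OF this, of "\<lambda>n. if n = 0 then \<phi> else \<psi>"] show ?thesis by simp
qed

text \<open>Zorn's lemma for the consistent extensions of \<open>\<Gamma>\<close>: inconsistency is
  witnessed by a finite list, and a list over the union of a chain already lies in one
  member.\<close>

lemma lindenbaum:
  assumes "consistent_set \<Lambda> \<Gamma>"
  obtains w where "mcs w" "\<Gamma> \<subseteq> w"
proof -
  let ?A = "{\<Delta>. \<Gamma> \<subseteq> \<Delta> \<and> consistent_set \<Lambda> \<Delta>}"
  have "\<exists>M\<in>?A. \<forall>X\<in>?A. M \<subseteq> X \<longrightarrow> X = M"
  proof (rule subset_Zorn_nonempty)
    show "?A \<noteq> {}" using assms by blast
  next
    fix C assume "C \<noteq> {}" and chain: "subset.chain ?A C"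
    then have C: "C \<subseteq> ?A" by (simp add: subset_chain_def)
    have "consistent_set \<Lambda> (\<Union>C)"
      unfolding consistent_set_def
    proof
      assume "\<exists>\<phi>s. set \<phi>s \<subseteq> \<Union>C \<and> Neg (Conj \<phi>s) \<in> \<Lambda>"
      then obtain \<phi>s where "set \<phi>s \<subseteq> \<Union>C" and *: "Neg (Conj \<phi>s) \<in> \<Lambda>" by blast
      then obtain B where "B \<in> C" "set \<phi>s \<subseteq> B"
        using finite_subset_Union_chain[of "set \<phi>s" C ?A] \<open>C \<noteq> {}\<close> chain by auto
      moreover have "consistent_set \<Lambda> B" using C \<open>B \<in> C\<close> by blast
      ultimately show False using * unfolding consistent_set_def by blast
    qed
    moreover have "\<Gamma> \<subseteq> \<Union>C" using C \<open>C \<noteq> {}\<close> by blast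
    ultimately show "\<Union>C \<in> ?A" by simp
  qed
  then obtain M where M: "\<Gamma> \<subseteq> M" "consistent_set \<Lambda> M"
    and max: "\<forall>X\<in>?A. M \<subseteq> X \<longrightarrow> X = M" by blast
  have "\<not> consistent_set \<Lambda> \<Delta>" if "M \<subset> \<Delta>" for \<Delta>
  proof
    assume "consistent_set \<Lambda> \<Delta>"
    with that M(1) have "\<Delta> \<in> ?A" by auto
    with max that show False by auto
  qed
  with M have "mcs M" unfolding maximal_consistent_def by simp
  with M(1) show ?thesis by (rule that[rotated])
qed

text \<open>If \<open>\<psi>\<close> were missing, some list over \<open>insert \<psi> w\<close>
  would be refuted; trading \<open>\<psi>\<close> in it for \<open>\<phi>s\<close> gives a refuted
  list over \<open>w\<close> itself.\<close>

lemma mcs_closed: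
  assumes w: "mcs w" and "set \<phi>s \<subseteq> w" and "Imp (Conj \<phi>s) \<psi> \<in> \<Lambda>"
  shows "\<psi> \<in> w"
proof (rule ccontr)
  assume "\<psi> \<notin> w"
  with w have "\<not> consistent_set \<Lambda> (insert \<psi> w)"
    unfolding maximal_consistent_def by blast
  then obtain \<psi>s where \<psi>s: "set \<psi>s \<subseteq> insert \<psi> w" "Neg (Conj \<psi>s) \<in> \<Lambda>"
    unfolding consistent_set_def by blast
  let ?\<chi>s = "\<phi>s @ filter (\<lambda>\<chi>. \<chi> \<in> w) \<psi>s"
  have "Imp (Neg (Conj \<psi>s)) (Neg (Conj ?\<chi>s)) \<in> \<Lambda>"
  proof (rule taut_consequence[OF assms(3)])
    fix v assume *: "prop_eval v (Imp (Conj \<phi>s) \<psi>)"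
    show "prop_eval v (Imp (Neg (Conj \<psi>s)) (Neg (Conj ?\<chi>s)))"
      using * \<psi>s(1) by (auto simp: prop_eval_Conj)
  qed
  then have "Neg (Conj ?\<chi>s) \<in> \<Lambda>" using mp \<psi>s by blast
  moreover have "set ?\<chi>s \<subseteq> w" using assms(2) by auto
  ultimately show False using w unfolding maximal_consistent_def consistent_set_def by blast
qed

lemma mcs_theorem: "mcs w \<Longrightarrow> \<phi> \<in> \<Lambda> \<Longrightarrow> \<phi> \<in> w"
  by (rule mcs_closed[of w "[]"]) (auto elim: taut_consequence)

lemma mcs_Bot [simp]: assumes "mcs w" shows "Bot \<notin> w"
proof
  assume "Bot \<in> w"
  moreover have "Neg (Conj [Bot]) \<in> \<Lambda>" by (rule taut) (simp add: prop_eval_Conj)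
  ultimately show False
    using assms unfolding maximal_consistent_def consistent_set_def
    by (metis empty_set empty_subsetI insert_subset list.simps(15))
qed

lemma mcs_Imp [simp]:
  assumes w: "mcs w"
  shows "Imp \<phi> \<psi> \<in> w \<longleftrightarrow> (\<phi> \<in> w \<longrightarrow> \<psi> \<in> w)"
proof -
  have "\<psi> \<in> w" if "Imp \<phi> \<psi> \<in> w" "\<phi> \<in> w"
    by (rule mcs_closed[OF w, of "[Imp \<phi> \<psi>, \<phi>]"]) (use that in \<open>auto intro!: taut simp: prop_eval_Conj\<close>)
  moreover have "Imp \<phi> \<psi> \<in> w" if "\<psi> \<in> w"
    by (rule mcs_closed[OF w, of "[\<psi>]"]) (use that in \<open>auto intro!: taut simp: prop_eval_Conj\<close>)
  moreover have "Imp \<phi> \<psi> \<in> w" if "\<phi> \<notin> w"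
  proof -
    from w that have "\<not> consistent_set \<Lambda> (insert \<phi> w)"
      unfolding maximal_consistent_def by blast
    then obtain \<psi>s where \<psi>s: "set \<psi>s \<subseteq> insert \<phi> w" "Neg (Conj \<psi>s) \<in> \<Lambda>"
      unfolding consistent_set_def by blast
    show ?thesis
    proof (rule mcs_closed[OF w, of "filter (\<lambda>\<chi>. \<chi> \<in> w) \<psi>s"])
      show "Imp (Conj (filter (\<lambda>\<chi>. \<chi> \<in> w) \<psi>s)) (Imp \<phi> \<psi>) \<in> \<Lambda>"
        by (rule taut_consequence[OF \<psi>s(2)]) (use \<psi>s(1) in \<open>auto simp: prop_eval_Conj\<close>)
    qed auto
  qed
  ultimately show ?thesis by blast
qed

lemma mcs_Conj [simp]: "mcs w \<Longrightarrow> Conj \<phi>s \<in> w \<longleftrightarrow> set \<phi>s \<subseteq> w"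
  by (induction \<phi>s) (auto simp: Conj_def)

lemma mcs_Dia_mono: "mcs w \<Longrightarrow> Dia \<phi> \<in> w \<Longrightarrow> Imp \<phi> \<psi> \<in> \<Lambda> \<Longrightarrow> Dia \<psi> \<in> w"
  using mcs_theorem[OF _ Dia_Imp] by fastforce

text \<open>\<open>Dia_Or\<close> iterated along the list; \<open>Dia_Bot\<close> excludes the empty
  one.\<close>

lemma mcs_Dia_Neg_Conj:
  assumes w: "mcs w" and "Dia (Neg (Conj \<phi>s)) \<in> w"
  shows "\<exists>\<phi>\<in>set \<phi>s. Dia (Neg \<phi>) \<in> w"
  using assms(2)
proof (induction \<phi>s)
  case Nil
  have "Dia Bot \<in> w"
    by (rule mcs_Dia_mono[OF w Nil]) (auto intro!: taut simp: prop_eval_Conj)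
  then show ?case using mcs_theorem[OF w Dia_Bot] w by simp
next
  case (Cons \<phi> \<phi>s)
  have "Dia (Or (Neg \<phi>) (Neg (Conj \<phi>s))) \<in> w"
    by (rule mcs_Dia_mono[OF w Cons.prems]) (auto intro!: taut simp: prop_eval_Conj)
  then have "Dia (Neg \<phi>) \<in> w \<or> Dia (Neg (Conj \<phi>s)) \<in> w"
    using mcs_theorem[OF w Dia_Or[of "Neg \<phi>" "Neg (Conj \<phi>s)"]] w by auto
  then show ?case using Cons.IH by auto
qed

text \<open>A compactness form of the existence lemma. Besides singletons, it serves later for an
  infinite \<open>\<Gamma>\<close>: the theory of a set of worlds with one formula added.\<close>

lemma acc_existence:
  assumes w: "mcs w" and \<Gamma>: "\<And>\<phi>s. set \<phi>s \<subseteq> \<Gamma> \<Longrightarrow> Dia (Conj \<phi>s) \<in> w"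
  obtains v where "acc w v" "\<Gamma> \<subseteq> v"
proof -
  have "consistent_set \<Lambda> (\<Gamma> \<union> {\<phi>. Box \<phi> \<in> w})"
    unfolding consistent_set_def
  proof
    assume "\<exists>\<phi>s. set \<phi>s \<subseteq> \<Gamma> \<union> {\<phi>. Box \<phi> \<in> w} \<and> Neg (Conj \<phi>s) \<in> \<Lambda>"
    then obtain \<phi>s where \<phi>s: "set \<phi>s \<subseteq> \<Gamma> \<union> {\<phi>. Box \<phi> \<in> w}" "Neg (Conj \<phi>s) \<in> \<Lambda>"
      by blast
    \<comment> \<open>The refuted list is covered by its members in \<open>\<Gamma>\<close> and
      those boxed at \<open>w\<close>, so the former jointly imply that one of the latter
      fails.\<close>
    let ?\<psi>s = "filter (\<lambda>\<phi>. \<phi> \<in> \<Gamma>) \<phi>s" and ?\<chi>s = "filter (\<lambda>\<phi>. Box \<phi> \<in> w) \<phi>s"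
    have "Dia (Neg (Conj ?\<chi>s)) \<in> w"
    proof (rule mcs_Dia_mono[OF w])
      show "Dia (Conj ?\<psi>s) \<in> w" by (rule \<Gamma>) auto
      show "Imp (Conj ?\<psi>s) (Neg (Conj ?\<chi>s)) \<in> \<Lambda>"
        by (rule taut_consequence[OF \<phi>s(2)]) (use \<phi>s(1) in \<open>auto simp: prop_eval_Conj\<close>)
    qed
    from mcs_Dia_Neg_Conj[OF w this] show False using w by auto
  qed
  then obtain v where "mcs v" "\<Gamma> \<union> {\<phi>. Box \<phi> \<in> w} \<subseteq> v" by (rule lindenbaum)
  then have "acc w v" "\<Gamma> \<subseteq> v" using w unfolding acc_iff by blast+
  then show ?thesis by (rule that)
qed

lemma Dia_mcs_iff:
  assumes w: "mcs w"
  shows "Dia \<phi> \<in> w \<longleftrightarrow> (\<exists>v. acc w v \<and> \<phi> \<in> v)"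
proof
  assume \<phi>: "Dia \<phi> \<in> w"
  have "Dia (Conj \<phi>s) \<in> w" if "set \<phi>s \<subseteq> {\<phi>}" for \<phi>s
    by (rule mcs_Dia_mono[OF w \<phi>], rule taut) (use that in \<open>auto simp: prop_eval_Conj\<close>)
  then obtain v where "acc w v" "{\<phi>} \<subseteq> v" by (rule acc_existence[OF w])
  then show "\<exists>v. acc w v \<and> \<phi> \<in> v" by blast
next
  assume "\<exists>v. acc w v \<and> \<phi> \<in> v"
  then obtain v where v: "acc w v" "\<phi> \<in> v" by blast
  show "Dia \<phi> \<in> w"
  proof (rule ccontr)
    assume "Dia \<phi> \<notin> w"
    moreover have "Imp (Neg (Neg \<phi>)) \<phi> \<in> \<Lambda>" by (rule taut) simp
    ultimately have "Dia (Neg (Neg \<phi>)) \<notin> w" using mcs_Dia_mono[OF w] by blast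
    then have "Box (Neg \<phi>) \<in> w" using w by simp
    then have "Neg \<phi> \<in> v" by (rule acc_Box[OF v(1)])
    then show False using v acc_mcs[OF v(1)] by simp
  qed
qed

lemma Box_mcs_iff:
  assumes "mcs w"
  shows "Box \<phi> \<in> w \<longleftrightarrow> (\<forall>v. acc w v \<longrightarrow> \<phi> \<in> v)"
proof -
  have "Box \<phi> \<in> w \<longleftrightarrow> \<not> (\<exists>v. acc w v \<and> Neg \<phi> \<in> v)" using assms by (simp add: Dia_mcs_iff)
  also have "\<dots> \<longleftrightarrow> (\<forall>v. acc w v \<longrightarrow> \<phi> \<in> v)"
    using mcs_Imp[OF acc_mcs(2)] mcs_Bot[OF acc_mcs(2)] by blast
  finally show ?thesis .
qed

section \<open>Finite acyclic selections\<close>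

text \<open>Only the chosen witness edges \<open>E\<close> must be acyclic; the canonical relation
  itself may have cycles on \<open>W\<close>.\<close>

definition selection :: "fm set \<Rightarrow> fm set set \<Rightarrow> fm set rel \<Rightarrow> bool" where
  "selection S W E \<longleftrightarrow> finite W \<and> E \<subseteq> W \<times> W \<and> acyclic E \<and> (\<forall>w v. (w, v) \<in> E \<longrightarrow> acc w v) \<and>
     (\<forall>w\<in>W. \<forall>\<psi>\<in>S. Dia \<psi> \<in> w \<longrightarrow> (\<exists>v. (w, v) \<in> E \<and> \<psi> \<in> v))"

lemma selectionD:
  assumes "selection S W E"
  shows "finite W" "E \<subseteq> W \<times> W" "acyclic E" "\<And>w v. (w, v) \<in> E \<Longrightarrow> acc w v"
    and selection_successor:
      "\<And>w \<psi>. w \<in> W \<Longrightarrow> \<psi> \<in> S \<Longrightarrow> Dia \<psi> \<in> w \<Longrightarrow> \<exists>v. (w, v) \<in> E \<and> \<psi> \<in> v"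
  using assms by (simp_all add: selection_def)

definition selectable :: "fm set \<Rightarrow> fm set set" where
  "selectable S = \<Union>{W. \<exists>E. selection S W E}"

text \<open>No edge of either relation leaves \<open>W\<close>. Hence a path starting in
  \<open>W\<close> uses only \<open>E\<close>, a path ending outside \<open>W\<close> uses only
  \<open>E'\<close>, and a cycle is of one of these kinds.\<close>

lemma acyclic_priority_Un:
  assumes "acyclic E" "E \<subseteq> W \<times> W" "acyclic E'" "\<And>x y. (x, y) \<in> E' \<Longrightarrow> x \<notin> W"
  shows "acyclic (E \<union> E')"
proof -
  have in_W: "y \<in> W \<and> (x, y) \<in> E\<^sup>+" if "(x, y) \<in> (E \<union> E')\<^sup>+" "x \<in> W" for x y
    using that(1)
  proof induction
    case (base y)
    then show ?case using assms(2,4) that(2) by blast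
  next
    case (step y z)
    then have "(y, z) \<in> E" using assms(4) by blast
    then show ?case using step.IH assms(2) by (meson SigmaD2 subsetD trancl.trancl_into_trancl)
  qed
  have out_W: "y \<in> W \<or> (x, y) \<in> E'\<^sup>+" if "(x, y) \<in> (E \<union> E')\<^sup>+" for x y
    using that
  proof induction
    case (base y)
    then show ?case using assms(2) by blast
  next
    case (step y z)
    show ?case
    proof (cases "y \<in> W")
      case True
      then show ?thesis using step.hyps(2) assms(2,4) by blast
    next
      case False
      then have "(y, z) \<in> E'" using step.hyps(2) assms(2) by blast
      then show ?thesis using step.IH False by (meson trancl.trancl_into_trancl)
    qed
  qed
  show ?thesis
    unfolding acyclic_def
  proof (intro allI notI)
    fix x assume x: "(x, x) \<in> (E \<union> E')\<^sup>+"
    then show False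
      using in_W[OF x] out_W[OF x] assms(1,3) unfolding acyclic_def by blast
  qed
qed

text \<open>Worlds in both sets keep only their \<open>E\<close>-successors, which prevents cycles.\<close>

lemma selection_Un:
  assumes W: "selection S W E" and W': "selection S W' E'"
  shows "selection S (W \<union> W') (E \<union> {e \<in> E'. fst e \<notin> W})" (is "selection S ?W (E \<union> ?E')")
proof -
  have "acyclic ?E'" by (rule acyclic_subset[OF selectionD(3)[OF W']]) blast
  then have "acyclic (E \<union> ?E')"
    by (intro acyclic_priority_Un[OF selectionD(3)[OF W] selectionD(2)[OF W]]) auto
  moreover have "\<exists>v. (x, v) \<in> E \<union> ?E' \<and> \<psi> \<in> v" if "x \<in> ?W" "\<psi> \<in> S" "Dia \<psi> \<in> x" for x \<psi>
  proof (cases "x \<in> W")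
    case True
    then show ?thesis using selection_successor[OF W True that(2,3)] by blast
  next
    case False
    then have "x \<in> W'" using that by blast
    from selection_successor[OF W' this that(2,3)] False show ?thesis by auto
  qed
  moreover have "acc x y" if "(x, y) \<in> E \<union> ?E'" for x y
    using that selectionD(4)[OF W] selectionD(4)[OF W'] by blast
  moreover have "E \<union> ?E' \<subseteq> ?W \<times> ?W" using selectionD(2)[OF W] selectionD(2)[OF W'] by blast
  moreover have "finite ?W" using selectionD(1)[OF W] selectionD(1)[OF W'] by blast
  ultimately show ?thesis unfolding selection_def by simp
qed

lemma selection_finite:
  assumes "finite X" "X \<subseteq> selectable S"
  shows "\<exists>W E. selection S W E \<and> X \<subseteq> W"
  using assms
proof (induction X)
  case empty
  have "selection S {} {}" by (simp add: selection_def acyclic_def)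
  then show ?case by blast
next
  case (insert x X)
  then obtain W E W' E' where "selection S W E" "X \<subseteq> W" "selection S W' E'" "x \<in> W'"
    by (auto simp: selectable_def)
  moreover from this have "insert x X \<subseteq> W \<union> W'" by blast
  ultimately show ?case using selection_Un[of S W E W' E'] by blast
qed

text \<open>One selection covers a chosen witness for each \<open>\<psi>\<close>; unless
  \<open>w\<close> is already in it, \<open>w\<close> is put on top with edges to these
  witnesses.\<close>

lemma selectableI:
  assumes "finite S" "mcs w"
    and ex: "\<And>\<psi>. \<psi> \<in> S \<Longrightarrow> Dia \<psi> \<in> w \<Longrightarrow> \<exists>v\<in>selectable S. acc w v \<and> \<psi> \<in> v"
  shows "w \<in> selectable S"
proof -
  obtain f where f: "\<And>\<psi>. \<psi> \<in> S \<Longrightarrow> Dia \<psi> \<in> w \<Longrightarrow> f \<psi> \<in> selectable S \<and> acc w (f \<psi>) \<and> \<psi> \<in> f \<psi>"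
    using ex by metis
  let ?X = "f ` {\<psi> \<in> S. Dia \<psi> \<in> w}"
  have "finite ?X" "?X \<subseteq> selectable S" using assms(1) f by auto
  then obtain W E where W: "selection S W E" "?X \<subseteq> W" using selection_finite by metis
  show ?thesis
  proof (cases "w \<in> W")
    case True
    with W show ?thesis by (auto simp: selectable_def)
  next
    case False
    let ?E = "{w} \<times> ?X"
    have "w \<notin> ?X" using False W by blast
    then have "acyclic ?E"
      by (intro acyclicI_order[where f = "\<lambda>x. if x = w then 1 else (0::nat)"]) auto
    then have "acyclic (E \<union> ?E)"
      using False by (intro acyclic_priority_Un[OF selectionD(3)[OF W(1)] selectionD(2)[OF W(1)]]) auto
    moreover have "\<exists>v. (x, v) \<in> E \<union> ?E \<and> \<psi> \<in> v"
      if "x \<in> insert w W" "\<psi> \<in> S" "Dia \<psi> \<in> x" for x \<psi>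
    proof (cases "x = w")
      case True
      then have "(x, f \<psi>) \<in> ?E" "\<psi> \<in> f \<psi>" using that f by auto
      then show ?thesis by blast
    next
      case False
      then have "x \<in> W" using that by blast
      from selection_successor[OF W(1) this that(2,3)] show ?thesis by blast
    qed
    moreover have "acc x y" if "(x, y) \<in> E \<union> ?E" for x y
    proof (cases "(x, y) \<in> E")
      case True
      then show ?thesis by (rule selectionD(4)[OF W(1)])
    next
      case False
      then show ?thesis using that f by auto
    qed
    moreover have "E \<union> ?E \<subseteq> insert w W \<times> insert w W"
      using W(2) selectionD(2)[OF W(1)] by blast
    moreover have "finite (insert w W)" using selectionD(1)[OF W(1)] by simp
    ultimately have "selection S (insert w W) (E \<union> ?E)"
      unfolding selection_def by simp
    then show ?thesis unfolding selectable_def by blast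
  qed
qed

text \<open>Within a selection, every member of \<open>X\<close> has an \<open>E\<close>-successor
  in \<open>X\<close> again, which is impossible for a finite acyclic \<open>E\<close>.\<close>

lemma not_selectableI:
  assumes X: "\<And>e. e \<in> X \<Longrightarrow> \<exists>\<psi>\<in>S. Dia \<psi> \<in> e \<and> (\<forall>v. acc e v \<and> \<psi> \<in> v \<longrightarrow> v \<in> X)"
    and "e \<in> X"
  shows "e \<notin> selectable S"
proof
  assume "e \<in> selectable S"
  then obtain W E where W: "selection S W E" "e \<in> W" by (auto simp: selectable_def)
  have "finite E" using selectionD(1,2)[OF W(1)] finite_subset by blast
  then have wf: "wf (E\<inverse>)" using selectionD(3)[OF W(1)] by (rule finite_acyclic_wf_converse)
  have "x \<notin> X \<inter> W" for x
    using wf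
  proof induction
    case (less x)
    show ?case
    proof
      assume x: "x \<in> X \<inter> W"
      then obtain \<psi> where \<psi>: "\<psi> \<in> S" "Dia \<psi> \<in> x" "\<And>v. acc x v \<Longrightarrow> \<psi> \<in> v \<Longrightarrow> v \<in> X"
        using X by blast
      then obtain v where "(x, v) \<in> E" "\<psi> \<in> v"
        using selection_successor[OF W(1)] x by blast
      moreover from this have "v \<in> X" "v \<in> W"
        using selectionD(2,4)[OF W(1)] \<psi>(3) by blast+
      ultimately show False using less by blast
    qed
  qed
  then show False using assms(2) W by blast
qed

end

section \<open>The axiom in the canonical frame\<close>

locale GL_sigma_logic = normal_modal_logic +
  fixes n :: nat
  assumes n: "n \<ge> 1" and GL_sigma: "GL_sigma n \<subseteq> \<Lambda>"
begin

abbreviation sigma_fm :: "fm \<Rightarrow> nat \<Rightarrow> fm" where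
  "sigma_fm \<phi> k \<equiv> subst (\<lambda>_. \<phi>) (sigma 0 k)"

text \<open>The formula to which the axiom leads: it holds at a \<open>\<phi>\<close>-world none of
  whose successors starts a walk through \<open>n\<close> worlds satisfying
  \<open>\<phi>\<close>.\<close>

definition last_fm :: "fm \<Rightarrow> fm" where
  "last_fm \<phi> = And \<phi> (Neg (Dia (sigma_fm \<phi> n)))"

lemma last_fm_mcs [simp]:
  "mcs w \<Longrightarrow> last_fm \<phi> \<in> w \<longleftrightarrow> \<phi> \<in> w \<and> Dia (sigma_fm \<phi> n) \<notin> w"
  by (auto simp: last_fm_def)

lemma Dia_last_fm:
  assumes "mcs w" "Dia \<phi> \<in> w"
  shows "Dia (last_fm \<phi>) \<in> w"
proof -
  have "Imp (Dia (Var 0)) (Dia (And (Var 0) (Neg (Dia (sigma 0 n))))) \<in> \<Lambda>"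
    using GL_sigma by (auto simp: GL_sigma_def logic_plus_def)
  from subst_closed[OF this, of "\<lambda>_. \<phi>"] have "Imp (Dia \<phi>) (Dia (last_fm \<phi>)) \<in> \<Lambda>"
    by (simp add: last_fm_def)
  from mcs_theorem[OF assms(1) this] show ?thesis using assms by simp
qed

text \<open>\<open>sigma_fm \<phi> k\<close> expresses a walk through \<open>k\<close> worlds
  satisfying \<open>\<phi>\<close>, counting the first; inside \<open>X\<close> walks never get
  stuck.\<close>

lemma sigma_fm_walk:
  assumes "\<And>x. x \<in> X \<Longrightarrow> mcs x \<and> \<phi> \<in> x \<and> (\<exists>y\<in>X. acc x y)" "x \<in> X"
  shows "sigma_fm \<phi> (Suc k) \<in> x"
  using assms(2)
proof (induction k arbitrary: x)
  case 0
  then show ?case using assms(1) by simp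
next
  case (Suc k)
  then have x: "mcs x" "\<phi> \<in> x" using assms(1) by blast+
  have "Dia (sigma_fm \<phi> (Suc k)) \<in> x"
    using assms(1)[OF Suc.prems] Suc.IH by (auto simp: Dia_mcs_iff)
  then show ?case using x by simp
qed

lemma last_fm_no_walk:
  assumes X: "\<And>x. x \<in> X \<Longrightarrow> mcs x \<and> \<phi> \<in> x \<and> (\<exists>y\<in>X. acc x y)" and "x \<in> X"
  shows "last_fm \<phi> \<notin> x"
proof -
  obtain y where y: "y \<in> X" "acc x y" using assms by blast
  \<comment> \<open>Here \<open>n \<ge> 1\<close> matters, since \<open>sigma 0 0\<close> is
    unspecified.\<close>
  have "sigma_fm \<phi> n \<in> y" using sigma_fm_walk[OF X y(1), of "n - 1"] n by simp
  then show ?thesis using y X[OF \<open>x \<in> X\<close>] by (auto simp: Dia_mcs_iff)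
qed

lemma last_fm_irrefl:
  assumes "last_fm \<phi> \<in> x"
  shows "\<not> acc x x"
proof
  assume x: "acc x x"
  then have "mcs x" by (rule acc_mcs)
  then have "\<phi> \<in> x" using assms by simp
  then show False using last_fm_no_walk[of "{x}" \<phi> x] assms x \<open>mcs x\<close> by blast
qed

section \<open>Every canonical world is selectable\<close>

lemma mcs_selectable:
  assumes S: "finite S" and "mcs w"
  shows "w \<in> selectable S"
proof (rule ccontr)
  define D where "D = {d. mcs d \<and> d \<notin> selectable S}"
  \<comment> \<open>The formulas in \<open>Th\<close> define the basic neighbourhoods of
    \<open>D\<close>; the worlds including \<open>Th\<close> form its topological closure.\<close>
  define Th where "Th = {\<pi>. \<forall>d\<in>D. \<pi> \<in> d}"
  assume "w \<notin> selectable S"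
  then have "D \<noteq> {}" using \<open>mcs w\<close> by (auto simp: D_def)
  have D_mcs: "mcs d" if "d \<in> D" for d using that by (simp add: D_def)
  have D_step: "\<exists>\<psi>\<in>S. Dia \<psi> \<in> d \<and> (\<forall>v. acc d v \<and> \<psi> \<in> v \<longrightarrow> v \<in> D)" if "d \<in> D" for d
    using selectableI[OF S, of d] that by (auto simp: D_def dest: acc_mcs)
  have Th_Conj: "Conj \<pi>s \<in> Th" if "set \<pi>s \<subseteq> Th" for \<pi>s
    using that by (auto simp: Th_def D_mcs)
  \<comment> \<open>the worlds satisfying \<open>Th\<close> have the defining property of \<open>D\<close>, by compactness over the finite \<open>S\<close>\<close>
  have D_closed: "e \<in> D" if e: "mcs e" "Th \<subseteq> e" for e
  proof -
    let ?X = "{e. mcs e \<and> Th \<subseteq> e}"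
    have "\<exists>\<psi>\<in>S. Dia \<psi> \<in> x \<and> (\<forall>v. acc x v \<and> \<psi> \<in> v \<longrightarrow> v \<in> ?X)" if x: "x \<in> ?X" for x
    proof -
      have "mcs x" using x by blast
      have "\<exists>\<psi>\<in>S. Dia \<psi> \<in> x \<and> (\<forall>\<pi>\<in>Th. Box (Imp \<psi> \<pi>) \<in> x)"
      proof (rule ccontr)
        assume neg: "\<not> ?thesis"
        have "\<exists>\<pi>. \<psi> \<in> S \<longrightarrow> \<pi> \<in> Th \<and> \<not> (Dia \<psi> \<in> x \<and> Box (Imp \<psi> \<pi>) \<in> x)" for \<psi>
        proof (cases "\<psi> \<in> S \<and> Dia \<psi> \<in> x")
          case True
          then show ?thesis using neg by blast
        next
          case False
          \<comment> \<open>An arbitrary member of \<open>Th\<close> serves as default.\<close>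
          have "Conj [] \<in> Th" by (rule Th_Conj) simp
          then show ?thesis using False by blast
        qed
        then obtain \<pi> where \<pi>: "\<And>\<psi>. \<psi> \<in> S \<Longrightarrow> \<pi> \<psi> \<in> Th \<and> \<not> (Dia \<psi> \<in> x \<and> Box (Imp \<psi> (\<pi> \<psi>)) \<in> x)"
          by metis
        obtain \<psi>s where \<psi>s: "set \<psi>s = S" using finite_list[OF S] by blast
        let ?f = "\<lambda>\<psi>. Imp (Dia \<psi>) (Neg (Box (Imp \<psi> (\<pi> \<psi>))))"
        \<comment> \<open>This formula says that for some \<open>\<psi>\<close> in \<open>S\<close>
          both \<open>Dia \<psi>\<close> and \<open>Box (Imp \<psi> (\<pi> \<psi>))\<close> hold.
          \<open>D_step\<close> makes it true throughout \<open>D\<close>, hence at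
          \<open>x\<close>, against the choice of \<open>\<pi>\<close>.\<close>
        have "Neg (Conj (map ?f \<psi>s)) \<in> Th"
          unfolding Th_def
        proof (intro CollectI ballI)
          fix d assume d: "d \<in> D"
          then obtain \<psi> where \<psi>: "\<psi> \<in> S" "Dia \<psi> \<in> d" "\<And>v. acc d v \<Longrightarrow> \<psi> \<in> v \<Longrightarrow> v \<in> D"
            using D_step by blast
          have "Imp \<psi> (\<pi> \<psi>) \<in> v" if "acc d v" for v
            using that \<psi> \<pi>[OF \<psi>(1)] by (auto simp: acc_mcs Th_def)
          then have "Box (Imp \<psi> (\<pi> \<psi>)) \<in> d" using Box_mcs_iff[OF D_mcs[OF d]] by blast
          then have "?f \<psi> \<notin> d" using \<psi> D_mcs[OF d] by simp
          then show "Neg (Conj (map ?f \<psi>s)) \<in> d" using \<psi> \<psi>s D_mcs[OF d] by auto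
        qed
        then have "Conj (map ?f \<psi>s) \<notin> x" using x \<open>mcs x\<close> by auto
        moreover have "?f \<psi> \<in> x" if "\<psi> \<in> S" for \<psi>
          using \<pi>[OF that] \<open>mcs x\<close> by auto
        ultimately show False using \<psi>s \<open>mcs x\<close> by auto
      qed
      then obtain \<psi> where \<psi>: "\<psi> \<in> S" "Dia \<psi> \<in> x" "\<And>\<pi>. \<pi> \<in> Th \<Longrightarrow> Box (Imp \<psi> \<pi>) \<in> x"
        by blast
      have "v \<in> ?X" if "acc x v" "\<psi> \<in> v" for v
      proof -
        have "mcs v" by (rule acc_mcs(2)) fact
        moreover have "\<pi> \<in> v" if "\<pi> \<in> Th" for \<pi>
        proof -
          have "Imp \<psi> \<pi> \<in> v"
            using \<psi>(3)[OF that] \<open>acc x v\<close> Box_mcs_iff[OF \<open>mcs x\<close>] by blast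
          then show ?thesis using \<open>mcs v\<close> \<open>\<psi> \<in> v\<close> by simp
        qed
        ultimately show ?thesis by blast
      qed
      then show ?thesis using \<psi> by blast
    qed
    then have "e \<notin> selectable S" by (rule not_selectableI[of ?X]) (use e in simp_all)
    then show ?thesis using e by (simp add: D_def)
  qed
  define T where "T d = {\<psi>\<in>S. Dia \<psi> \<in> d \<and> (\<forall>v. acc d v \<and> \<psi> \<in> v \<longrightarrow> v \<in> D)}" for d
  define B where "B d = {\<psi>\<in>S. \<forall>\<pi>\<in>Th. \<exists>v. acc d v \<and> \<psi> \<in> v \<and> \<pi> \<in> v \<and> v \<notin> D}" for d
  have T_nonempty: "T d \<noteq> {}" if "d \<in> D" for d
    using D_step[OF that] by (auto simp: T_def)
  \<comment> \<open>With this trivial neighbourhood, a member of \<open>B d\<close> has a witness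
    outside \<open>D\<close>, which \<open>T d\<close> forbids.\<close>
  have "Conj [] \<in> Th" by (rule Th_Conj) simp
  then have TB: "T d \<inter> B d = {}" for d by (auto simp: T_def B_def)
  have B_D: "\<exists>v\<in>D. acc d v \<and> \<psi> \<in> v" if "d \<in> D" "\<psi> \<in> B d" for d \<psi>
  proof -
    \<comment> \<open>Finite parts of \<open>Th\<close> amount to one neighbourhood, so compactness
      gives a successor satisfying \<open>\<psi>\<close> and all of \<open>Th\<close>; by
      \<open>D_closed\<close> it lies in \<open>D\<close>.\<close>
    have "Dia (Conj \<phi>s) \<in> d" if \<phi>s: "set \<phi>s \<subseteq> insert \<psi> Th" for \<phi>s
    proof -
      have "Conj (filter (\<lambda>\<phi>. \<phi> \<in> Th) \<phi>s) \<in> Th" by (rule Th_Conj) auto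
      then obtain v where v: "acc d v" "\<psi> \<in> v" "Conj (filter (\<lambda>\<phi>. \<phi> \<in> Th) \<phi>s) \<in> v"
        using \<open>\<psi> \<in> B d\<close> by (auto simp: B_def)
      then have "Conj \<phi>s \<in> v" using \<phi>s acc_mcs(2)[OF v(1)] by auto
      then show ?thesis using v Dia_mcs_iff[OF D_mcs[OF \<open>d \<in> D\<close>]] by blast
    qed
    then obtain v where "acc d v" "insert \<psi> Th \<subseteq> v"
      by (rule acc_existence[OF D_mcs[OF \<open>d \<in> D\<close>]])
    then show ?thesis using D_closed[OF acc_mcs(2)] by blast
  qed
  obtain a where a: "a \<in> D" and a_min: "\<And>d. d \<in> D \<Longrightarrow> card (B a) \<le> card (B d)"
    using \<open>D \<noteq> {}\<close> ex_has_least_nat[of "\<lambda>d. d \<in> D" _ "\<lambda>d. card (B d)"] by blast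
  \<comment> \<open>Outside \<open>B a\<close>, some neighbourhood of \<open>D\<close> excludes all
    \<open>\<psi>\<close>-successors of \<open>a\<close> not in \<open>D\<close>.\<close>
  have "\<exists>\<pi>. \<psi> \<in> S - B a \<longrightarrow> \<pi> \<in> Th \<and> (\<forall>v. acc a v \<and> \<psi> \<in> v \<and> \<pi> \<in> v \<longrightarrow> v \<in> D)" for \<psi>
    by (auto simp: B_def)
  then obtain \<pi> where \<pi>: "\<And>\<psi>. \<psi> \<in> S - B a \<Longrightarrow>
      \<pi> \<psi> \<in> Th \<and> (\<forall>v. acc a v \<and> \<psi> \<in> v \<and> \<pi> \<psi> \<in> v \<longrightarrow> v \<in> D)"
    by metis
  obtain \<psi>s where \<psi>s: "set \<psi>s = S - B a" using finite_list[of "S - B a"] S by blast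
  \<comment> \<open>The disjunction of \<open>And \<psi> (\<pi> \<psi>)\<close> over
    \<open>S - B a\<close>: by the choice of \<open>\<pi>\<close>, successors of \<open>a\<close>
    satisfying it lie in \<open>D\<close>.\<close>
  define p where "p = Neg (Conj (map (\<lambda>\<psi>. Neg (And \<psi> (\<pi> \<psi>))) \<psi>s))"
  have p_iff: "p \<in> v \<longleftrightarrow> (\<exists>\<psi>\<in>S - B a. \<psi> \<in> v \<and> \<pi> \<psi> \<in> v)" if "mcs v" for v
    using that \<psi>s by (auto simp: p_def)
  have p_D: "p \<in> v" if "v \<in> D" "\<psi> \<in> S - B a" "\<psi> \<in> v" for v \<psi>
    using that \<pi>[of \<psi>] p_iff[OF D_mcs[OF that(1)]] by (auto simp: Th_def)
  have "\<exists>v\<in>D. acc a v \<and> last_fm p \<in> v"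
  proof -
    obtain \<psi> where \<psi>: "\<psi> \<in> T a" using T_nonempty[OF a] by blast
    then obtain u where u: "acc a u" "\<psi> \<in> u" "u \<in> D"
      using Dia_mcs_iff[OF D_mcs[OF a]] by (auto simp: T_def)
    have "\<psi> \<in> S - B a" using \<psi> TB by (auto simp: T_def)
    then have "p \<in> u" using p_D u by blast
    then have "Dia p \<in> a" using u Dia_mcs_iff[OF D_mcs[OF a]] by blast
    then have "Dia (last_fm p) \<in> a" by (rule Dia_last_fm[OF D_mcs[OF a]])
    then obtain v where v: "acc a v" "last_fm p \<in> v" using Dia_mcs_iff[OF D_mcs[OF a]] by blast
    then have "mcs v" by (blast dest: acc_mcs)
    then have "p \<in> v" using v by simp
    then have "v \<in> D" using v(1) \<pi> p_iff[OF \<open>mcs v\<close>] by blast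
    then show ?thesis using v by blast
  qed
  moreover have "last_fm p \<notin> v" if v: "v \<in> D" for v
  proof
    assume last: "last_fm p \<in> v"
    have "mcs x \<and> p \<in> x \<and> (\<exists>y\<in>{x\<in>D. p \<in> x}. acc x y)" if x: "x \<in> {x\<in>D. p \<in> x}" for x
    proof -
      have "x \<in> D" using x by blast
      \<comment> \<open>Minimality of \<open>B a\<close> enters here; the inclusion of
        \<open>B x\<close> would be strict because \<open>T x\<close> contributes further
        elements.\<close>
      have "\<exists>\<psi>\<in>T x \<union> B x. \<psi> \<notin> B a"
      proof (rule ccontr)
        assume "\<not> ?thesis"
        then have "T x \<union> B x \<subseteq> B a" by blast
        then have "B x \<subset> B a" using T_nonempty[OF \<open>x \<in> D\<close>] TB by blast
        moreover have "finite (B a)" using S by (simp add: B_def)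
        ultimately have "card (B x) < card (B a)" by (metis psubset_card_mono)
        then show False using a_min[OF \<open>x \<in> D\<close>] by simp
      qed
      then obtain \<psi> where \<psi>: "\<psi> \<in> T x \<union> B x" "\<psi> \<notin> B a" by blast
      have "\<exists>y\<in>D. acc x y \<and> \<psi> \<in> y"
      proof (cases "\<psi> \<in> B x")
        case True
        then show ?thesis by (rule B_D[OF \<open>x \<in> D\<close>])
      next
        case False
        then have "Dia \<psi> \<in> x" "\<And>v. acc x v \<Longrightarrow> \<psi> \<in> v \<Longrightarrow> v \<in> D"
          using \<psi>(1) by (simp_all add: T_def)
        then show ?thesis using Dia_mcs_iff[OF D_mcs[OF \<open>x \<in> D\<close>]] by blast
      qed
      moreover have "\<psi> \<in> S - B a" using \<psi> by (auto simp: T_def B_def)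
      ultimately have "\<exists>y\<in>{x\<in>D. p \<in> x}. acc x y" using p_D by blast
      then show ?thesis using x D_mcs[OF \<open>x \<in> D\<close>] by simp
    qed
    moreover have "v \<in> {x\<in>D. p \<in> x}" using v last D_mcs[OF v] by simp
    ultimately show False using last_fm_no_walk[of "{x\<in>D. p \<in> x}" p v] last by blast
  qed
  ultimately show False by blast
qed

end

section \<open>Finite models\<close>

primrec subfms :: "fm \<Rightarrow> fm set" where
  "subfms (Var k) = {Var k}"
| "subfms Bot = {Bot}"
| "subfms (Imp \<phi> \<psi>) = insert (Imp \<phi> \<psi>) (subfms \<phi> \<union> subfms \<psi>)"
| "subfms (Dia \<phi>) = insert (Dia \<phi>) (subfms \<phi>)"

lemma finite_subfms: "finite (subfms \<phi>)"
  by (induction \<phi>) auto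

lemma subfms_self: "\<phi> \<in> subfms \<phi>"
  by (cases \<phi>) auto

context GL_sigma_logic
begin

lemma finite_countermodel:
  assumes "\<phi> \<notin> \<Lambda>"
  obtains F where "semisubframe F (canonical_frame \<Lambda>)" "finite_frame F" "conversely_wf F"
    "\<not> valid_in F \<phi>"
proof -
  have "consistent_set \<Lambda> {Neg \<phi>}"
    unfolding consistent_set_def
  proof
    assume "\<exists>\<phi>s. set \<phi>s \<subseteq> {Neg \<phi>} \<and> Neg (Conj \<phi>s) \<in> \<Lambda>"
    then obtain \<phi>s where \<phi>s: "set \<phi>s \<subseteq> {Neg \<phi>}" "Neg (Conj \<phi>s) \<in> \<Lambda>" by blast
    have "\<phi> \<in> \<Lambda>"
      by (rule taut_consequence[OF \<phi>s(2)]) (use \<phi>s(1) in \<open>auto simp: prop_eval_Conj\<close>)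
    with assms show False by blast
  qed
  then obtain w' where "mcs w'" "{Neg \<phi>} \<subseteq> w'" by (rule lindenbaum)
  then have w': "mcs w'" "Neg \<phi> \<in> w'" by simp_all
  \<comment> \<open>The root must survive the removal of reflexive worlds: if \<open>w'\<close> sees
    \<open>Neg \<phi>\<close>, a last such world is taken, and otherwise \<open>w'\<close> does not
    see itself.\<close>
  have "\<exists>w. mcs w \<and> Neg \<phi> \<in> w \<and> \<not> acc w w"
  proof (cases "Dia (Neg \<phi>) \<in> w'")
    case True
    then have "Dia (last_fm (Neg \<phi>)) \<in> w'" by (rule Dia_last_fm[OF w'(1)])
    then obtain w where w: "acc w' w" "last_fm (Neg \<phi>) \<in> w" using Dia_mcs_iff[OF w'(1)] by blast
    then have "Neg \<phi> \<in> w" using acc_mcs(2) last_fm_mcs by blast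
    then show ?thesis using w acc_mcs(2) last_fm_irrefl by blast
  next
    case False
    then have "\<not> acc w' w'" using w' Dia_mcs_iff[OF w'(1)] by blast
    with w' show ?thesis by blast
  qed
  then obtain w where w: "mcs w" "Neg \<phi> \<in> w" "\<not> acc w w" by blast
  have "w \<in> selectable (last_fm ` subfms \<phi>)"
    by (rule mcs_selectable[OF finite_imageI[OF finite_subfms] w(1)])
  then obtain W E where sel: "selection (last_fm ` subfms \<phi>) W E" and "w \<in> W"
    unfolding selectable_def by blast
  \<comment> \<open>Removing reflexive worlds loses no witnesses, by \<open>last_fm_irrefl\<close>,
    and keeps loops out of \<open>R\<close>.\<close>
  define W' where "W' = {v \<in> W. mcs v \<and> \<not> acc v v}"
  define E' where "E' = E \<inter> W' \<times> W'"
  \<comment> \<open>All canonical edges along \<open>E'\<close>-paths are added, as a semisubframe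
    requires; being canonical, they preserve the truth lemma.\<close>
  define R where "R = {(x, y) \<in> E'\<^sup>*. x \<in> W' \<and> y \<in> W' \<and> acc x y}"
  have "w \<in> W'" using w \<open>w \<in> W\<close> by (simp add: W'_def)
  have W'_mcs: "mcs v" if "v \<in> W'" for v using that by (simp add: W'_def)
  have "finite W'" using selectionD(1)[OF sel] by (simp add: W'_def)
  have R_iff: "(x, y) \<in> R \<longleftrightarrow> (x, y) \<in> E'\<^sup>* \<and> x \<in> W' \<and> y \<in> W' \<and> acc x y" for x y
    by (simp add: R_def)
  have E'_iff: "(x, y) \<in> E' \<longleftrightarrow> (x, y) \<in> E \<and> x \<in> W' \<and> y \<in> W'" for x y
    by (simp add: E'_def)
  have "R \<subseteq> E'\<^sup>+"
  proof (rule subrelI)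
    fix x y assume "(x, y) \<in> R"
    then have "(x, y) \<in> E'\<^sup>*" "x \<noteq> y" by (auto simp: R_iff W'_def)
    then show "(x, y) \<in> E'\<^sup>+" by (simp add: rtrancl_eq_or_trancl)
  qed
  have "E' \<subseteq> R"
    by (rule subrelI) (simp add: R_iff E'_iff r_into_rtrancl selectionD(4)[OF sel])
  have "acyclic E'" by (rule acyclic_subset[OF selectionD(3)[OF sel]]) (simp add: E'_def)
  moreover have "finite E'"
    by (rule finite_subset[of _ "W' \<times> W'"]) (use \<open>finite W'\<close> in \<open>simp_all add: E'_def\<close>)
  ultimately have "wf ((E'\<^sup>+)\<inverse>)"
    by (metis finite_acyclic_wf_converse trancl_converse wf_trancl)
  then have "wf (R\<inverse>)" by (rule wf_subset) (use \<open>R \<subseteq> E'\<^sup>+\<close> in blast)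
  then have "conversely_wf (W', R)"
    by (simp add: conversely_wf_def wf_iff_no_infinite_down_chain)
  moreover have "finite_frame (W', R)" using \<open>finite W'\<close> by (simp add: finite_frame_def)
  moreover have "semisubframe (W', R) (canonical_frame \<Lambda>)"
  proof -
    \<comment> \<open>Reachability does not grow when passing from \<open>E'\<close> to
      \<open>R\<close>, so no further closure is needed.\<close>
    have "R\<^sup>* \<subseteq> E'\<^sup>*" by (intro rtrancl_subset_rtrancl subrelI) (simp add: R_iff)
    then have "(x, y) \<in> R" if "x \<in> W'" "y \<in> W'" "(x, y) \<in> R\<^sup>*" "acc x y" for x y
      using that R_iff by blast
    moreover have "R \<subseteq> W' \<times> W'" by (rule subrelI) (simp add: R_iff)
    moreover have "R \<subseteq> snd (canonical_frame \<Lambda>)" by (rule subrelI) (simp add: R_iff acc_def)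
    moreover have "W' \<subseteq> fst (canonical_frame \<Lambda>)"
      using W'_mcs by (simp add: canonical_frame_def subsetI)
    ultimately show ?thesis
      using \<open>w \<in> W'\<close> unfolding semisubframe_def is_frame_def acc_def fst_conv snd_conv by blast
  qed
  moreover have "\<not> valid_in (W', R) \<phi>"
  proof -
    let ?V = "\<lambda>k. {v \<in> W'. Var k \<in> v}"
    have "sat (W', R) ?V v \<chi> \<longleftrightarrow> \<chi> \<in> v" if "subfms \<chi> \<subseteq> subfms \<phi>" "v \<in> W'" for \<chi> v
      using that
    proof (induction \<chi> arbitrary: v)
      case (Dia \<chi>)
      have IH: "sat (W', R) ?V u \<chi> \<longleftrightarrow> \<chi> \<in> u" if "u \<in> W'" for u
        using Dia that by auto
      have "\<chi> \<in> subfms \<phi>" using Dia.prems subfms_self[of \<chi>] by auto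
      have "mcs v" using Dia.prems W'_mcs by blast
      have "\<exists>u\<in>W'. (v, u) \<in> R \<and> \<chi> \<in> u" if "Dia \<chi> \<in> v"
      proof -
        have "Dia (last_fm \<chi>) \<in> v" using Dia_last_fm[OF \<open>mcs v\<close> that] .
        moreover have "v \<in> W" using Dia.prems by (simp add: W'_def)
        ultimately obtain u where u: "(v, u) \<in> E" "last_fm \<chi> \<in> u"
          using selection_successor[OF sel _ imageI[OF \<open>\<chi> \<in> subfms \<phi>\<close>]] by blast
        then have "u \<in> W" "mcs u"
          using selectionD(2)[OF sel] acc_mcs(2)[OF selectionD(4)[OF sel]] by blast+
        then have "u \<in> W'" "\<chi> \<in> u" using u last_fm_irrefl[OF u(2)] by (simp_all add: W'_def)
        then have "(v, u) \<in> R" using \<open>E' \<subseteq> R\<close> u Dia.prems by (simp add: E'_iff subsetD)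
        then show ?thesis using \<open>u \<in> W'\<close> \<open>\<chi> \<in> u\<close> by blast
      qed
      moreover have "Dia \<chi> \<in> v" if "\<exists>u\<in>W'. (v, u) \<in> R \<and> \<chi> \<in> u"
        using that Dia_mcs_iff[OF \<open>mcs v\<close>] R_iff by blast
      ultimately show ?case using IH unfolding sat.simps fst_conv snd_conv by blast
    qed (simp_all add: W'_mcs)
    then have "sat (W', R) ?V w \<phi> \<longleftrightarrow> \<phi> \<in> w" using \<open>w \<in> W'\<close> by blast
    then have "\<not> sat (W', R) ?V w \<phi>" using w by simp
    moreover have "\<forall>k. ?V k \<subseteq> W'" by blast
    ultimately show ?thesis
      using \<open>w \<in> W'\<close> unfolding valid_in_def fst_conv by (meson spec[where x = ?V])
  qed
  ultimately show ?thesis using that by blast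
qed

end

section \<open>Transfer to frames over the natural numbers\<close>

definition frame_image :: "('a \<Rightarrow> 'b) \<Rightarrow> 'a frame \<Rightarrow> 'b frame" where
  "frame_image f F = (f ` fst F, map_prod f f ` snd F)"

lemma sat_frame_image:
  assumes "is_frame F" "inj_on f (fst F)" "\<And>k. V k \<subseteq> fst F" "w \<in> fst F"
  shows "sat (frame_image f F) (\<lambda>k. f ` V k) (f w) \<phi> \<longleftrightarrow> sat F V w \<phi>"
  using assms(4)
proof (induction \<phi> arbitrary: w)
  case (Var k)
  then show ?case using assms(2,3) by (simp add: inj_on_image_mem_iff)
next
  case (Dia \<phi>)
  have "(f w, f v) \<in> snd (frame_image f F) \<longleftrightarrow> (w, v) \<in> snd F" if "v \<in> fst F" for v
    using that assms(1,2) Dia.prems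
    by (force simp: frame_image_def is_frame_def map_prod_def inj_on_eq_iff)
  then show ?case using Dia by (auto simp: frame_image_def)
qed auto

lemma valid_in_frame_image:
  fixes f :: "'a \<Rightarrow> 'b"
  assumes "is_frame F" "inj_on f (fst F)"
  shows "valid_in (frame_image f F) \<phi> \<longleftrightarrow> valid_in F \<phi>"
proof
  assume L: "valid_in (frame_image f F) \<phi>"
  show "valid_in F \<phi>"
    unfolding valid_in_def
  proof (intro allI impI ballI)
    fix V :: "nat \<Rightarrow> 'a set" and w assume V: "\<forall>k. V k \<subseteq> fst F" and w: "w \<in> fst F"
    then have "\<forall>k. f ` V k \<subseteq> fst (frame_image f F)" by (simp add: frame_image_def image_mono)
    then have "sat (frame_image f F) (\<lambda>k. f ` V k) (f w) \<phi>"
      using L w unfolding valid_in_def by (simp add: frame_image_def)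
    then show "sat F V w \<phi>" using sat_frame_image[OF assms] V w by blast
  qed
next
  assume R: "valid_in F \<phi>"
  show "valid_in (frame_image f F) \<phi>"
    unfolding valid_in_def
  proof (intro allI impI ballI)
    fix V :: "nat \<Rightarrow> 'b set" and x assume V: "\<forall>k. V k \<subseteq> fst (frame_image f F)" and x: "x \<in> fst (frame_image f F)"
    define U where "U k = {w \<in> fst F. f w \<in> V k}" for k
    have "V k = f ` U k" for k
      using V[rule_format, of k] by (auto simp: U_def frame_image_def)
    then have U: "V = (\<lambda>k. f ` U k)" by blast
    have U_sub: "\<And>k. U k \<subseteq> fst F" by (auto simp: U_def)
    obtain w where w: "w \<in> fst F" "x = f w" using x by (auto simp: frame_image_def)
    have "sat F U w \<phi>" using R U_sub w unfolding valid_in_def by blast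
    then show "sat (frame_image f F) V x \<phi>"
      using sat_frame_image[OF assms U_sub w(1)] U w(2) by simp
  qed
qed

text \<open>The class taken is that of all finite frames over \<open>nat\<close> validating
  \<open>\<Lambda>\<close>; countermodels of any world type enter it through an injection of their
  finitely many worlds.\<close>

lemma finite_model_propertyI:
  assumes "\<And>\<phi>. \<phi> \<notin> \<Lambda> \<Longrightarrow>
    \<exists>F :: 'w frame. is_frame F \<and> finite_frame F \<and> logic_valid_in F \<Lambda> \<and> \<not> valid_in F \<phi>"
  shows "finite_model_property \<Lambda>"
proof -
  let ?C = "{F :: nat frame. is_frame F \<and> finite_frame F \<and> logic_valid_in F \<Lambda>}"
  have "\<phi> \<in> \<Lambda>" if \<phi>: "\<forall>F\<in>?C. valid_in F \<phi>" for \<phi>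
  proof (rule ccontr)
    assume "\<phi> \<notin> \<Lambda>"
    then obtain F :: "'w frame" where F: "is_frame F" "finite_frame F" "logic_valid_in F \<Lambda>"
      "\<not> valid_in F \<phi>" using assms by blast
    then obtain f :: "'w \<Rightarrow> nat" where f: "inj_on f (fst F)"
      using finite_imp_inj_to_nat_seg unfolding finite_frame_def by blast
    have "is_frame (frame_image f F)" "finite_frame (frame_image f F)"
      using F by (auto simp: is_frame_def finite_frame_def frame_image_def)
    then have "frame_image f F \<in> ?C"
      using F f by (simp add: logic_valid_in_def valid_in_frame_image)
    then have "valid_in (frame_image f F) \<phi>" using \<phi> by blast
    then show False using F(4) valid_in_frame_image[OF F(1) f] by simp
  qed
  moreover have "valid_in F \<phi>" if "\<phi> \<in> \<Lambda>" "F \<in> ?C" for F \<phi>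
    using that by (simp add: logic_valid_in_def)
  ultimately have "\<Lambda> = {\<phi>. \<forall>F\<in>?C. valid_in F \<phi>}" by (intro set_eqI) blast
  then show ?thesis unfolding finite_model_property_def by (intro exI[of _ ?C]) simp
qed

theorem theorem3p2:
  fixes \<Lambda> :: "fm set"
  assumes "normal_logic \<Lambda>"
    and "consistent_logic \<Lambda>"
    and "\<And>F. semisubframe F (canonical_frame \<Lambda>) \<Longrightarrow> finite_frame F \<Longrightarrow> conversely_wf F
               \<Longrightarrow> logic_valid_in F \<Lambda>"
    and "\<exists>n\<ge>1. GL_sigma n \<subseteq> \<Lambda>"
  shows "finite_model_property \<Lambda>"
proof (rule finite_model_propertyI)
  fix \<phi> assume "\<phi> \<notin> \<Lambda>"
  obtain n where "n \<ge> 1" "GL_sigma n \<subseteq> \<Lambda>" using assms(4) by blast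
  then interpret GL_sigma_logic \<Lambda> n using assms(1) by unfold_locales
  obtain F where F: "semisubframe F (canonical_frame \<Lambda>)" "finite_frame F" "conversely_wf F"
    "\<not> valid_in F \<phi>" using finite_countermodel[OF \<open>\<phi> \<notin> \<Lambda>\<close>] by blast
  moreover have "is_frame F" using F(1) by (simp add: semisubframe_def)
  ultimately show "\<exists>F :: fm set frame. is_frame F \<and> finite_frame F \<and> logic_valid_in F \<Lambda> \<and> \<not> valid_in F \<phi>"
    using assms(3) by blast
qed

end
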